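(* Let the abstract $hp$-framework, the routines $\mathbf{hp}$-$\mathbf{NEARBEST}$ (with constants $0<b\le 1\le B$) and $\mathbf{REDUCE}$, and the practical algorithm $\mathbf{hp}$-$\mathbf{AFEM}$ be as described in the context. Assume that there are constants $C_1,C_2>0$ with $C_1C_2<b$, and for each $\mathcal D\in\mathbb D$ a constant $C_{3,\mathcal D}$, such that $$\|u(f,\lambda)-u(f_{\mathcal D},\lambda_{\mathcal D})\|_V\le C_1\inf_{w\in V}E_{\mathcal D}(w,f,\lambda)^{1/2}\qquad\forall \mathcal D\in\mathbb D,\ \forall (f,\lambda)\in F\times\Lambda,$$ $$\sup_{(f,\lambda)\in F\times\Lambda}\big|E_{\mathcal D}(w,f,\lambda)^{1/2}-E_{\mathcal D}(v,f,\lambda)^{1/2}\big|\le C_2\|w-v\|_V\qquad\forall\mathcal D\in\mathbb D,\ \forall v,w\in V,$$ $$\inf_{w\in V^c_{\mathcal C(\mathcal D)}}\|v-w\|_V\le C_{3,\mathcal D}\inf_{(f,\lambda)\in F\times\Lambda}E_{\mathcal D}(v,f,\lambda)^{1/2}\qquad\forall\mathcal D\in\mathbb D,\ \forall v\in V.$$ Let $(f,\lambda)\in F\times\Lambda$, $u:=u(f,\lambda)$, $\bar u_0\in V$, $\varepsilon_0>0$ with $\|u-\bar u_0\|_V\le\varepsilon_0$, and let $\mu\in(0,1)$, $\omega>0$ satisfy $C_1C_2<b(1-\mu)$ and $\omega\in\big(\tfrac{C_2}{b},\tfrac{1-\mu}{C_1}\big)$. Then the sequences $(\bar u_i)$, $(\mathcal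 D_i)$ produced by the practical $\mathbf{hp}$-$\mathbf{AFEM}$, with $\varepsilon_i=(\mu+C_1\omega)^i\varepsilon_0$, satisfy $$\|u-\bar u_i\|_V\le\varepsilon_i\quad\forall i\ge0,\qquad E_{\mathcal D_i}(u,f,\lambda)^{1/2}\le(\omega+C_2)\varepsilon_{i-1}\quad\forall i\ge1,$$ and, for all $i\ge 1$, $$\#\mathcal D_i\le B\,\#\mathcal D\quad\text{for any }\mathcal D\in\mathbb D\text{ with }E_{\mathcal D}(u,f,\lambda)^{1/2}\le(b\omega-C_2)\varepsilon_{i-1}.$$
   Context: **Problem.** $\Omega\subset\mathbb R^n$ is a domain, $V$, $F$ are real Hilbert spaces of functions on $\Omega$, $\bar\Lambda$ is a set of functions (parameters) on $\Omega$; for all $(f,\lambda)\in F\times\bar\Lambda$ the problem $A_\lambda u=f$ has a unique solution $u=u(f,\lambda)\in V$. $\Lambda\subseteq\bar\Lambda$ is the set of admissible parameters. **$h$-partitions.** An initial essentially disjoint partition of $\bar\Omega$ into finitely many closed element domains is given; each element domain $K$ can be split in a unique way into two children $K',K''$ with $K=K'\cup K''$, $|K'\cap K''|=0$. The set $\mathfrak K$ of all element domains so obtained is an infinite binary master tree. A finite subset is a subtree if it contains all roots and, for each element in it that is not a root, also its parent and sibling. The leaves of a subtree form an $h$-partition; $\mathbb K$ is the set of all $h$-partitions. $\mathcal K\le\tilde{\mathcal K}$ means that each $K\in\tilde{\mathcal K}$ is in $\mathcal K$ or has an ancestor in $\mathcal K$. **Local spaces.** For $K\in\mathfrak K$ there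 are spaces $V_K,F_K,\Lambda_K$ of functions on $K$ such that for each $\mathcal K\in\mathbb K$, $V\subseteq\prod_{K\in\mathcal K}V_K$, $F=\prod_{K\in\mathcal K}F_K$, $\Lambda\subseteq\prod_{K\in\mathcal K}\Lambda_K\subseteq\bar\Lambda$. For $(K,d)\in\mathfrak K\times\mathbb N$ ($\mathbb N$ = positive integers) and $Z\in\{V,F,\Lambda\}$ there are finite dimensional $Z_{K,d}\subset Z_K$ with $Z_{K,d}\subseteq Z_{K,d+1}$, $Z_{K,d}\subset Z_{K',d}\times Z_{K'',d}$, and $Z\cap\bigcup_{\mathcal K\in\mathbb K,d\in\mathbb N}\prod_{K\in\mathcal K}Z_{K,d}$ dense in $Z$. **$hp$-partitions.** An $hp$-element is a pair $D=(K_D,d_D)\in\mathfrak K\times\mathbb N$; $Z_D:=Z_{K_D,d_D}$. An $hp$-partition is a collection $\mathcal D$ of $hp$-elements with $\mathcal K(\mathcal D):=\{K_D:D\in\mathcal D\}\in\mathbb K$; $\mathbb D$ is the set of all of them; $\#\mathcal D:=\sum_{D\in\mathcal D}d_D$; $Z_{\mathcal D}:=\prod_{D\in\mathcal D}Z_D$; $V^c_{\mathcal D}:=V_{\mathcal D}\cap V$. $\mathcal D\le\tilde{\mathcal D}$ means $\mathcal K(\mathcal D)\le\mathcal K(\tilde{\mathcal D})$ and $d_{\tilde D}\ge d_D$ whenever $D\in\mathcal D$, $\tilde D\in\tilde{\mathcal D}$ and $K_D$ equals or is an ancestor of $K_{\tilde D}$. **Projectors and error functionals.** For each $hp$-element $D$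 there are a projector $Q_D:V\times F\times\Lambda\to V_D\times F_D\times\Lambda_D$, $Q_D(v,f,\lambda)=(v_D,f_D,\lambda_D)$, where $(f_D,\lambda_D)$ depends only on $(f,\lambda)$, and a local error functional $e_D(v,f,\lambda)\ge0$ such that $e_{D'}+e_{D''}\le e_D$ if $K_{D'},K_{D''}$ are the children of $K_D$ and $d_{D'}=d_{D''}=d_D$, and $e_{D'}\le e_D$ if $K_{D'}=K_D$ and $d_{D'}\ge d_D$. Set $E_{\mathcal D}(v,f,\lambda):=\sum_{D\in\mathcal D}e_D(v,f,\lambda)$, $f_{\mathcal D}:=\prod_{D\in\mathcal D}f_D$, $\lambda_{\mathcal D}:=\prod_{D\in\mathcal D}\lambda_D$. **Conforming partitions.** $\mathbb D^c\subseteq\mathbb D$ is a given subset and $\mathcal C:\mathbb D\to\mathbb D^c$ a mapping with $\mathcal C(\mathcal D)\ge\mathcal D$ for all $\mathcal D\in\mathbb D$. **Routines.** - $[\mathcal D,f_{\mathcal D},\lambda_{\mathcal D}]:=\mathbf{hp}\text{-}\mathbf{NEARBEST}(\varepsilon,v,f,\lambda)$: for $\varepsilon>0$, $(v,f,\lambda)\in V\times F\times\Lambda$ it outputs $\mathcal D\in\mathbb D$ and $(f_{\mathcal D},\lambda_{\mathcal D})$ such that $E_{\mathcal D}(v,f,\lambda)^{1/2}\le\varepsilon$ and $\#\mathcal D\le B\#\hat{\mathcal D}$ for any $\hat{\mathcal D}\in\mathbb D$ with $E_{\hat{\mathcal D}}(v,f,\lambda)^{1/2}\le b\varepsilon$,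 where $0<b\le1\le B$ are fixed constants. - $[\bar{\mathcal D},\bar u]:=\mathbf{REDUCE}(\varrho,\mathcal D^\circ,g,\kappa)$: for $\varrho\in(0,1]$, $\mathcal D^\circ\in\mathbb D^c$ and $(g,\kappa)\in F_{\mathcal D^\circ}\times\Lambda_{\mathcal D^\circ}$ it outputs $\bar{\mathcal D}\in\mathbb D^c$ with $\bar{\mathcal D}\ge\mathcal D^\circ$ and $\bar u\in V^c_{\bar{\mathcal D}}$ with $\|u(g,\kappa)-\bar u\|_V\le\varrho\inf_{v\in V^c_{\mathcal D^\circ}}\|u(g,\kappa)-v\|_V$. **Practical algorithm $\mathbf{hp}$-$\mathbf{AFEM}(\bar u_0,f,\lambda,\varepsilon_0)$.** For $i=1,2,\dots$: $[\mathcal D_i,f_{\mathcal D_i},\lambda_{\mathcal D_i}]:=\mathbf{hp}\text{-}\mathbf{NEARBEST}(\omega\varepsilon_{i-1},\bar u_{i-1},f,\lambda)$; $[\bar{\mathcal D}_i,\bar u_i]:=\mathbf{REDUCE}\big(\tfrac{\mu}{1+(C_1+C_{3,\mathcal D_i})\omega},\mathcal C(\mathcal D_i),f_{\mathcal D_i},\lambda_{\mathcal D_i}\big)$; $\varepsilon_i:=(\mu+C_1\omega)\varepsilon_{i-1}$. *)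

theory Defs
  imports "HOL-Analysis.Analysis"
begin

section \<open>Functions modulo null sets\<close>

text \<open>
  ``Functions on a subset of Euclidean space'' are taken modulo equality almost everywhere, as in
  Lebesgue and Sobolev spaces. This is what makes it possible to identify a product of spaces over
  an essentially disjoint partition with a space of functions on the union. A function on a set S
  is represented by its extension by zero. Values lie in an arbitrary real vector space, so that
  vector- or matrix-valued functions are covered.
\<close>

definition ae_eq :: "('a::euclidean_space \<Rightarrow> 'b) \<Rightarrow> ('a \<Rightarrow> 'b) \<Rightarrow> bool" where
  "ae_eq f g \<longleftrightarrow> (AE x in lebesgue. f x = g x)"

lemma equivp_ae_eq: "equivp (ae_eq :: ('a::euclidean_space \<Rightarrow> 'b) \<Rightarrow> _)"
proof (rule equivpI)
  show "reflp (ae_eq :: ('a \<Rightarrow> 'b) \<Rightarrow> _)"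
    by (simp add: reflp_def ae_eq_def)
  show "symp (ae_eq :: ('a \<Rightarrow> 'b) \<Rightarrow> _)"
    by (simp add: symp_def ae_eq_def eq_commute)
  show "transp (ae_eq :: ('a \<Rightarrow> 'b) \<Rightarrow> _)"
  proof (rule transpI)
    fix f g h :: "'a \<Rightarrow> 'b"
    assume "ae_eq f g" "ae_eq g h"
    then show "ae_eq f h"
      unfolding ae_eq_def by (rule eventually_elim2) simp
  qed
qed

quotient_type (overloaded) ('a, 'b) aefun = "'a::euclidean_space \<Rightarrow> 'b" / ae_eq
  by (rule equivp_ae_eq)

instantiation aefun :: (euclidean_space, real_vector) real_vector
begin

lift_definition zero_aefun :: "('a, 'b) aefun" is "\<lambda>x. 0" .

lift_definition plus_aefun :: "('a, 'b) aefun \<Rightarrow> ('a, 'b) aefun \<Rightarrow> ('a, 'b) aefun"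
  is "\<lambda>f g x. f x + g x"
  unfolding ae_eq_def by (erule (1) eventually_elim2) simp

lift_definition minus_aefun :: "('a, 'b) aefun \<Rightarrow> ('a, 'b) aefun \<Rightarrow> ('a, 'b) aefun"
  is "\<lambda>f g x. f x - g x"
  unfolding ae_eq_def by (erule (1) eventually_elim2) simp

lift_definition uminus_aefun :: "('a, 'b) aefun \<Rightarrow> ('a, 'b) aefun"
  is "\<lambda>f x. - f x"
  unfolding ae_eq_def by (erule eventually_mono) simp

lift_definition scaleR_aefun :: "real \<Rightarrow> ('a, 'b) aefun \<Rightarrow> ('a, 'b) aefun"
  is "\<lambda>c f x. c *\<^sub>R f x"
  unfolding ae_eq_def by (erule eventually_mono) simp

instance
  by standard (transfer; simp add: ae_eq_def algebra_simps)+

end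

lift_definition restr :: "'a::euclidean_space set \<Rightarrow> ('a, 'b::real_vector) aefun \<Rightarrow> ('a, 'b) aefun"
  is "\<lambda>S f x. if x \<in> S then f x else 0"
  unfolding ae_eq_def by (erule eventually_mono) simp

definition functions_on :: "'a::euclidean_space set \<Rightarrow> ('a, 'b::real_vector) aefun set" where
  "functions_on S = {z. restr S z = z}"

text \<open>The product over i in I of spaces Z i of functions on the sets S i, where the S i are
  essentially disjoint: functions on the union whose restriction to each S i is in Z i.\<close>

definition piecewise ::
  "'i set \<Rightarrow> ('i \<Rightarrow> 'a::euclidean_space set) \<Rightarrow> ('i \<Rightarrow> ('a, 'b::real_vector) aefun set)
    \<Rightarrow> ('a, 'b) aefun set" where
  "piecewise I S Z = {z \<in> functions_on (\<Union>i\<in>I. S i). \<forall>i\<in>I. restr (S i) z \<in> Z i}"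


section \<open>Hilbert spaces on a carrier\<close>

definition ip_norm :: "('v \<Rightarrow> 'v \<Rightarrow> real) \<Rightarrow> 'v \<Rightarrow> real" where
  "ip_norm ip v = sqrt (ip v v)"

definition ip_dist :: "('v::real_vector \<Rightarrow> 'v \<Rightarrow> real) \<Rightarrow> 'v \<Rightarrow> 'v \<Rightarrow> real" where
  "ip_dist ip v w = ip_norm ip (v - w)"

definition hilbert_space_on :: "'v::real_vector set \<Rightarrow> ('v \<Rightarrow> 'v \<Rightarrow> real) \<Rightarrow> bool" where
  "hilbert_space_on H ip \<longleftrightarrow>
     subspace H \<and>
     (\<forall>x\<in>H. \<forall>y\<in>H. ip x y = ip y x) \<and>
     (\<forall>x\<in>H. \<forall>y\<in>H. \<forall>z\<in>H. ip (x + y) z = ip x z + ip y z) \<and>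
     (\<forall>c. \<forall>x\<in>H. \<forall>y\<in>H. ip (c *\<^sub>R x) y = c * ip x y) \<and>
     (\<forall>x\<in>H. ip x x \<ge> 0) \<and>
     (\<forall>x\<in>H. ip x x = 0 \<longrightarrow> x = 0) \<and>
     Metric_space.mcomplete H (ip_dist ip)"

definition finite_dimensional :: "'v::real_vector set \<Rightarrow> bool" where
  "finite_dimensional S \<longleftrightarrow> (\<exists>B. finite B \<and> S \<subseteq> span B)"


section \<open>The data of the abstract hp-framework\<close>

type_synonym 'n elem = "(real ^ 'n) set"
type_synonym 'n hpelem = "(real ^ 'n) set \<times> nat"
type_synonym 'n hppart = "((real ^ 'n) set \<times> nat) set"
type_synonym ('n, 'b) fn = "(real ^ 'n, 'b) aefun"

text \<open>
  The equation A_lam u = f is read in an arbitrary set that contains the values of all operators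
  A_lam; \<open>embF\<close> is the embedding of F in that set (for example of square-integrable functions in
  the dual of V). \<open>LamTop\<close> is the topology in which density in Lam is understood.
\<close>

record ('n, 'p, 'q, 'r, 'w) hp_data =
  Omega :: "(real ^ 'n) set"
  spV :: "('n, 'p) fn set"
  ipV :: "('n, 'p) fn \<Rightarrow> ('n, 'p) fn \<Rightarrow> real"
  spF :: "('n, 'q) fn set"
  ipF :: "('n, 'q) fn \<Rightarrow> ('n, 'q) fn \<Rightarrow> real"
  LamBar :: "('n, 'r) fn set"
  Lam :: "('n, 'r) fn set"
  LamTop :: "('n, 'r) fn topology"
  opA :: "('n, 'r) fn \<Rightarrow> ('n, 'p) fn \<Rightarrow> 'w"
  embF :: "('n, 'q) fn \<Rightarrow> 'w"
  roots :: "'n elem set"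
  childL :: "'n elem \<Rightarrow> 'n elem"
  childR :: "'n elem \<Rightarrow> 'n elem"
  locV :: "'n elem \<Rightarrow> ('n, 'p) fn set"
  locF :: "'n elem \<Rightarrow> ('n, 'q) fn set"
  locL :: "'n elem \<Rightarrow> ('n, 'r) fn set"
  hpV :: "'n hpelem \<Rightarrow> ('n, 'p) fn set"
  hpF :: "'n hpelem \<Rightarrow> ('n, 'q) fn set"
  hpL :: "'n hpelem \<Rightarrow> ('n, 'r) fn set"
  projV :: "'n hpelem \<Rightarrow> ('n, 'p) fn \<Rightarrow> ('n, 'q) fn \<Rightarrow> ('n, 'r) fn \<Rightarrow> ('n, 'p) fn"
  projF :: "'n hpelem \<Rightarrow> ('n, 'q) fn \<Rightarrow> ('n, 'r) fn \<Rightarrow> ('n, 'q) fn"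
  projL :: "'n hpelem \<Rightarrow> ('n, 'q) fn \<Rightarrow> ('n, 'r) fn \<Rightarrow> ('n, 'r) fn"
  err :: "'n hpelem \<Rightarrow> ('n, 'p) fn \<Rightarrow> ('n, 'q) fn \<Rightarrow> ('n, 'r) fn \<Rightarrow> real"
  confD :: "'n hppart set"
  conf :: "'n hppart \<Rightarrow> 'n hppart"


section \<open>The parametric problem\<close>

definition is_domain :: "'a::topological_space set \<Rightarrow> bool" where
  "is_domain U \<longleftrightarrow> open U \<and> connected U \<and> U \<noteq> {}"

definition normV :: "('n::finite, 'p::real_vector, 'q, 'r, 'w) hp_data \<Rightarrow> ('n, 'p) fn \<Rightarrow> real" where
  "normV S = ip_norm (ipV S)"

definition parametric_problem ::
  "('n::finite, 'p::real_vector, 'q::real_vector, 'r::real_vector, 'w) hp_data \<Rightarrow> bool" where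
  "parametric_problem S \<longleftrightarrow>
     is_domain (Omega S) \<and>
     spV S \<subseteq> functions_on (Omega S) \<and> hilbert_space_on (spV S) (ipV S) \<and>
     spF S \<subseteq> functions_on (Omega S) \<and> hilbert_space_on (spF S) (ipF S) \<and>
     LamBar S \<subseteq> functions_on (Omega S) \<and>
     Lam S \<subseteq> LamBar S \<and> topspace (LamTop S) = Lam S \<and>
     inj_on (embF S) (spF S) \<and>
     (\<forall>f\<in>spF S. \<forall>l\<in>LamBar S. \<exists>!v. v \<in> spV S \<and> opA S l v = embF S f)"

definition sol ::
  "('n::finite, 'p, 'q, 'r, 'w) hp_data \<Rightarrow> ('n, 'q) fn \<Rightarrow> ('n, 'r) fn \<Rightarrow> ('n, 'p) fn" where
  "sol S f l = (THE v. v \<in> spV S \<and> opA S l v = embF S f)"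


section \<open>h-partitions\<close>

inductive_set master_tree :: "('n::finite, 'p, 'q, 'r, 'w) hp_data \<Rightarrow> 'n elem set"
  for S :: "('n, 'p, 'q, 'r, 'w) hp_data" where
  root: "K \<in> roots S \<Longrightarrow> K \<in> master_tree S"
| left: "K \<in> master_tree S \<Longrightarrow> childL S K \<in> master_tree S"
| right: "K \<in> master_tree S \<Longrightarrow> childR S K \<in> master_tree S"

text \<open>A closed element domain is the closure of a domain. In particular it has positive measure,
  so that different nodes of the tree are different sets.\<close>

definition element_domain :: "'n::finite elem \<Rightarrow> bool" where
  "element_domain K \<longleftrightarrow> (\<exists>U. is_domain U \<and> K = closure U)"

definition h_framework :: "('n::finite, 'p, 'q, 'r, 'w) hp_data \<Rightarrow> bool" where
  "h_framework S \<longleftrightarrow>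
     finite (roots S) \<and> \<Union>(roots S) = closure (Omega S) \<and>
     (\<forall>K\<in>roots S. \<forall>K'\<in>roots S. K \<noteq> K' \<longrightarrow> K \<inter> K' \<in> null_sets lebesgue) \<and>
     (\<forall>K\<in>master_tree S. element_domain K \<and>
        K = childL S K \<union> childR S K \<and> childL S K \<inter> childR S K \<in> null_sets lebesgue)"

definition parent_rel :: "('n::finite, 'p, 'q, 'r, 'w) hp_data \<Rightarrow> ('n elem \<times> 'n elem) set" where
  "parent_rel S = {(P, K). P \<in> master_tree S \<and> (K = childL S P \<or> K = childR S P)}"

definition subtree :: "('n::finite, 'p, 'q, 'r, 'w) hp_data \<Rightarrow> 'n elem set \<Rightarrow> bool" where
  "subtree S T \<longleftrightarrow> finite T \<and> T \<subseteq> master_tree S \<and> roots S \<subseteq> T \<and>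
     (\<forall>K\<in>T - roots S. \<forall>P. (P, K) \<in> parent_rel S \<longrightarrow> P \<in> T \<and> childL S P \<in> T \<and> childR S P \<in> T)"

definition leaves :: "('n::finite, 'p, 'q, 'r, 'w) hp_data \<Rightarrow> 'n elem set \<Rightarrow> 'n elem set" where
  "leaves S T = {K\<in>T. childL S K \<notin> T \<and> childR S K \<notin> T}"

definition h_partitions :: "('n::finite, 'p, 'q, 'r, 'w) hp_data \<Rightarrow> 'n elem set set" where
  "h_partitions S = {leaves S T | T. subtree S T}"

definition h_le :: "('n::finite, 'p, 'q, 'r, 'w) hp_data \<Rightarrow> 'n elem set \<Rightarrow> 'n elem set \<Rightarrow> bool" where
  "h_le S \<K> \<K>' \<longleftrightarrow> (\<forall>K'\<in>\<K>'. K' \<in> \<K> \<or> (\<exists>K\<in>\<K>. (K, K') \<in> (parent_rel S)\<^sup>+))"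


section \<open>Local spaces\<close>

text \<open>The nesting conditions that V, F and the parameters have in common: \<open>ZK\<close> are the local
  spaces, \<open>Zd\<close> their finite dimensional subspaces. Linearity is not part of this predicate, since
  sets of parameters (for example uniformly positive coefficients) need not be linear.\<close>

definition nested_local_spaces ::
  "('n::finite, 'p, 'q, 'r, 'w) hp_data \<Rightarrow> ('n elem \<Rightarrow> ('n, 'z::real_vector) fn set)
    \<Rightarrow> ('n hpelem \<Rightarrow> ('n, 'z) fn set) \<Rightarrow> bool" where
  "nested_local_spaces S ZK Zd \<longleftrightarrow>
     (\<forall>K\<in>master_tree S. ZK K \<subseteq> functions_on K \<and>
        (\<forall>d\<ge>1. Zd (K, d) \<subseteq> ZK K \<and> finite_dimensional (Zd (K, d)) \<and>
           Zd (K, d) \<subseteq> Zd (K, d + 1) \<and>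
           Zd (K, d) \<subseteq> piecewise {childL S K, childR S K} (\<lambda>K'. K') (\<lambda>K'. Zd (K', d))))"

definition linear_local_spaces ::
  "('n::finite, 'p, 'q, 'r, 'w) hp_data \<Rightarrow> ('n elem \<Rightarrow> ('n, 'z::real_vector) fn set)
    \<Rightarrow> ('n hpelem \<Rightarrow> ('n, 'z) fn set) \<Rightarrow> bool" where
  "linear_local_spaces S ZK Zd \<longleftrightarrow>
     (\<forall>K\<in>master_tree S. subspace (ZK K) \<and> (\<forall>d\<ge>1. subspace (Zd (K, d))))"

definition approximants ::
  "('n::finite, 'p, 'q, 'r, 'w) hp_data \<Rightarrow> ('n hpelem \<Rightarrow> ('n, 'z::real_vector) fn set)
    \<Rightarrow> ('n, 'z) fn set" where
  "approximants S Zd =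
     (\<Union>\<K>\<in>h_partitions S. \<Union>d\<in>{1..}. piecewise \<K> (\<lambda>K. K) (\<lambda>K. Zd (K, d)))"

definition local_spaces ::
  "('n::finite, 'p::real_vector, 'q::real_vector, 'r::real_vector, 'w) hp_data \<Rightarrow> bool" where
  "local_spaces S \<longleftrightarrow>
     nested_local_spaces S (locV S) (hpV S) \<and> linear_local_spaces S (locV S) (hpV S) \<and>
     nested_local_spaces S (locF S) (hpF S) \<and> linear_local_spaces S (locF S) (hpF S) \<and>
     nested_local_spaces S (locL S) (hpL S) \<and>
     (\<forall>\<K>\<in>h_partitions S.
        spV S \<subseteq> piecewise \<K> (\<lambda>K. K) (locV S) \<and>
        spF S = piecewise \<K> (\<lambda>K. K) (locF S) \<and>
        Lam S \<subseteq> piecewise \<K> (\<lambda>K. K) (locL S) \<and>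
        piecewise \<K> (\<lambda>K. K) (locL S) \<subseteq> LamBar S) \<and>
     Metric_space.mtopology (spV S) (ip_dist (ipV S))
       closure_of (spV S \<inter> approximants S (hpV S)) = spV S \<and>
     Metric_space.mtopology (spF S) (ip_dist (ipF S))
       closure_of (spF S \<inter> approximants S (hpF S)) = spF S \<and>
     LamTop S closure_of (Lam S \<inter> approximants S (hpL S)) = Lam S"


section \<open>hp-partitions\<close>

definition hp_elements :: "('n::finite, 'p, 'q, 'r, 'w) hp_data \<Rightarrow> 'n hpelem set" where
  "hp_elements S = master_tree S \<times> {1..}"

text \<open>Each element of the underlying h-partition carries exactly one d, hence the injectivity.\<close>

definition hp_partitions :: "('n::finite, 'p, 'q, 'r, 'w) hp_data \<Rightarrow> 'n hppart set" where
  "hp_partitions S = {\<D>. \<D> \<subseteq> hp_elements S \<and> inj_on fst \<D> \<and> fst ` \<D> \<in> h_partitions S}"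

definition hp_card :: "'n::finite hppart \<Rightarrow> nat" where
  "hp_card \<D> = (\<Sum>D\<in>\<D>. snd D)"

definition hp_space :: "('n hpelem \<Rightarrow> ('n::finite, 'z::real_vector) fn set) \<Rightarrow> 'n hppart \<Rightarrow> ('n, 'z) fn set" where
  "hp_space Zd \<D> = piecewise \<D> fst Zd"

definition Vc ::
  "('n::finite, 'p::real_vector, 'q, 'r, 'w) hp_data \<Rightarrow> 'n hppart \<Rightarrow> ('n, 'p) fn set" where
  "Vc S \<D> = hp_space (hpV S) \<D> \<inter> spV S"

definition hp_le :: "('n::finite, 'p, 'q, 'r, 'w) hp_data \<Rightarrow> 'n hppart \<Rightarrow> 'n hppart \<Rightarrow> bool" where
  "hp_le S \<D> \<D>' \<longleftrightarrow> h_le S (fst ` \<D>) (fst ` \<D>') \<and>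
     (\<forall>D\<in>\<D>. \<forall>D'\<in>\<D>'. fst D = fst D' \<or> (fst D, fst D') \<in> (parent_rel S)\<^sup>+ \<longrightarrow> snd D \<le> snd D')"


section \<open>Projectors and error functionals\<close>

definition projQ ::
  "('n::finite, 'p, 'q, 'r, 'w) hp_data \<Rightarrow> 'n hpelem
    \<Rightarrow> ('n, 'p) fn \<times> ('n, 'q) fn \<times> ('n, 'r) fn \<Rightarrow> ('n, 'p) fn \<times> ('n, 'q) fn \<times> ('n, 'r) fn" where
  "projQ S D = (\<lambda>(v, f, l). (projV S D v f l, projF S D f l, projL S D f l))"

text \<open>As its range consists of functions on the element only, a projector is a map that leaves
  unchanged every triple whose restriction to the element already lies in the range space.\<close>

definition projectors ::
  "('n::finite, 'p::real_vector, 'q::real_vector, 'r::real_vector, 'w) hp_data \<Rightarrow> bool" where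
  "projectors S \<longleftrightarrow>
     (\<forall>D\<in>hp_elements S. \<forall>v\<in>spV S. \<forall>f\<in>spF S. \<forall>l\<in>Lam S.
        projQ S D (v, f, l) \<in> hpV S D \<times> hpF S D \<times> hpL S D \<and>
        (let r = (restr (fst D) v, restr (fst D) f, restr (fst D) l)
         in r \<in> hpV S D \<times> hpF S D \<times> hpL S D \<longrightarrow> projQ S D (v, f, l) = r))"

definition error_functionals :: "('n::finite, 'p, 'q, 'r, 'w) hp_data \<Rightarrow> bool" where
  "error_functionals S \<longleftrightarrow>
     (\<forall>v\<in>spV S. \<forall>f\<in>spF S. \<forall>l\<in>Lam S. \<forall>K\<in>master_tree S. \<forall>d\<ge>1.
        err S (K, d) v f l \<ge> 0 \<and>
        err S (childL S K, d) v f l + err S (childR S K, d) v f l \<le> err S (K, d) v f l \<and>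
        (\<forall>d'\<ge>d. err S (K, d') v f l \<le> err S (K, d) v f l))"

definition totalE ::
  "('n::finite, 'p, 'q, 'r, 'w) hp_data \<Rightarrow> 'n hppart
    \<Rightarrow> ('n, 'p) fn \<Rightarrow> ('n, 'q) fn \<Rightarrow> ('n, 'r) fn \<Rightarrow> real" where
  "totalE S \<D> v f l = (\<Sum>D\<in>\<D>. err S D v f l)"

text \<open>The local functions are extended by zero and their element domains are essentially disjoint,
  so the sums below are the functions on the whole domain with these restrictions.\<close>

definition partF ::
  "('n::finite, 'p, 'q::real_vector, 'r, 'w) hp_data \<Rightarrow> 'n hppart
    \<Rightarrow> ('n, 'q) fn \<Rightarrow> ('n, 'r) fn \<Rightarrow> ('n, 'q) fn" where
  "partF S \<D> f l = (\<Sum>D\<in>\<D>. projF S D f l)"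

definition partL ::
  "('n::finite, 'p, 'q, 'r::real_vector, 'w) hp_data \<Rightarrow> 'n hppart
    \<Rightarrow> ('n, 'q) fn \<Rightarrow> ('n, 'r) fn \<Rightarrow> ('n, 'r) fn" where
  "partL S \<D> f l = (\<Sum>D\<in>\<D>. projL S D f l)"


section \<open>The framework\<close>

definition conforming :: "('n::finite, 'p, 'q, 'r, 'w) hp_data \<Rightarrow> bool" where
  "conforming S \<longleftrightarrow> confD S \<subseteq> hp_partitions S \<and>
     (\<forall>\<D>\<in>hp_partitions S. conf S \<D> \<in> confD S \<and> hp_le S \<D> (conf S \<D>))"

definition hp_framework ::
  "('n::finite, 'p::real_vector, 'q::real_vector, 'r::real_vector, 'w) hp_data \<Rightarrow> bool" where
  "hp_framework S \<longleftrightarrow> parametric_problem S \<and> h_framework S \<and> local_spaces S \<and>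
     projectors S \<and> error_functionals S \<and> conforming S"


section \<open>Routines and the algorithm\<close>

type_synonym ('n, 'p, 'q, 'r) nearbest_routine =
  "real \<Rightarrow> ('n, 'p) fn \<Rightarrow> ('n, 'q) fn \<Rightarrow> ('n, 'r) fn \<Rightarrow> 'n hppart \<times> ('n, 'q) fn \<times> ('n, 'r) fn"

type_synonym ('n, 'p, 'q, 'r) reduce_routine =
  "real \<Rightarrow> 'n hppart \<Rightarrow> ('n, 'q) fn \<Rightarrow> ('n, 'r) fn \<Rightarrow> 'n hppart \<times> ('n, 'p) fn"

definition is_hp_nearbest ::
  "('n::finite, 'p::real_vector, 'q::real_vector, 'r::real_vector, 'w) hp_data \<Rightarrow> real \<Rightarrow> real
    \<Rightarrow> ('n, 'p, 'q, 'r) nearbest_routine \<Rightarrow> bool" where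
  "is_hp_nearbest S b B nearbest \<longleftrightarrow>
     (\<forall>\<epsilon>>0. \<forall>v\<in>spV S. \<forall>f\<in>spF S. \<forall>l\<in>Lam S. \<exists>\<D>\<in>hp_partitions S.
        nearbest \<epsilon> v f l = (\<D>, partF S \<D> f l, partL S \<D> f l) \<and>
        sqrt (totalE S \<D> v f l) \<le> \<epsilon> \<and>
        (\<forall>\<D>'\<in>hp_partitions S. sqrt (totalE S \<D>' v f l) \<le> b * \<epsilon> \<longrightarrow>
           real (hp_card \<D>) \<le> B * real (hp_card \<D>')))"

definition is_reduce ::
  "('n::finite, 'p::real_vector, 'q::real_vector, 'r::real_vector, 'w) hp_data
    \<Rightarrow> ('n, 'p, 'q, 'r) reduce_routine \<Rightarrow> bool" where
  "is_reduce S reduce \<longleftrightarrow>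
     (\<forall>\<rho>\<in>{0<..1}. \<forall>\<D>\<in>confD S. \<forall>g\<in>hp_space (hpF S) \<D>. \<forall>\<kappa>\<in>hp_space (hpL S) \<D>.
        \<exists>\<D>'\<in>confD S. \<exists>u'\<in>Vc S \<D>'.
          reduce \<rho> \<D> g \<kappa> = (\<D>', u') \<and> hp_le S \<D> \<D>' \<and>
          normV S (sol S g \<kappa> - u') \<le> \<rho> * (INF v\<in>Vc S \<D>. normV S (sol S g \<kappa> - v)))"

text \<open>The sequences start at index 0 for the iterates and tolerances, and at index 1 for the
  partitions and the data approximations (their values at 0 are irrelevant).\<close>

definition hp_afem_run ::
  "('n::finite, 'p, 'q, 'r, 'w) hp_data
    \<Rightarrow> ('n, 'p, 'q, 'r) nearbest_routine \<Rightarrow> ('n, 'p, 'q, 'r) reduce_routine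
    \<Rightarrow> real \<Rightarrow> ('n hppart \<Rightarrow> real) \<Rightarrow> real \<Rightarrow> real
    \<Rightarrow> ('n, 'p) fn \<Rightarrow> ('n, 'q) fn \<Rightarrow> ('n, 'r) fn \<Rightarrow> real
    \<Rightarrow> (nat \<Rightarrow> 'n hppart) \<Rightarrow> (nat \<Rightarrow> ('n, 'q) fn) \<Rightarrow> (nat \<Rightarrow> ('n, 'r) fn)
    \<Rightarrow> (nat \<Rightarrow> 'n hppart) \<Rightarrow> (nat \<Rightarrow> ('n, 'p) fn) \<Rightarrow> (nat \<Rightarrow> real) \<Rightarrow> bool" where
  "hp_afem_run S nearbest reduce C1 C3 \<mu> \<omega> u0 f l \<epsilon>0 \<D> fD lD \<D>bar ubar \<epsilon> \<longleftrightarrow>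
     ubar 0 = u0 \<and> \<epsilon> 0 = \<epsilon>0 \<and>
     (\<forall>i\<ge>1.
        (\<D> i, fD i, lD i) = nearbest (\<omega> * \<epsilon> (i - 1)) (ubar (i - 1)) f l \<and>
        (\<D>bar i, ubar i) =
          reduce (\<mu> / (1 + (C1 + C3 (\<D> i)) * \<omega>)) (conf S (\<D> i)) (fD i) (lD i) \<and>
        \<epsilon> i = (\<mu> + C1 * \<omega>) * \<epsilon> (i - 1))"

end

theory Submission
  imports Defs
begin

text \<open>
  The first two bounds are an induction on the iteration, in which every step contracts the
  tolerance by \<open>\<mu> + C1 * \<omega>\<close>. Suppose that the previous iterate \<open>v\<close> is within \<open>e\<close> of the exact
  solution \<open>u\<close>. The partition returned for the tolerance \<open>\<omega> * e\<close> serves two purposes: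
  replacing the data by their approximations moves the solution from \<open>u\<close> to some \<open>u'\<close> with
  \<open>\<parallel>u - u'\<parallel> \<le> C1 * \<omega> * e\<close>; the iterate \<open>v\<close> itself is approximable in the conforming space up to
  \<open>C3 * \<omega> * e\<close>; since \<open>\<parallel>u' - v\<parallel> \<le> \<parallel>u' - u\<parallel> + \<parallel>u - v\<parallel>\<close>, the distance of \<open>u'\<close> to that space is at most
  \<open>(1 + (C1 + C3) * \<omega>) * e\<close>. The reduction factor is chosen to turn this number into \<open>\<mu> * e\<close>, and
  the triangle inequality bounds the distance of \<open>u\<close> to the new iterate by \<open>(\<mu> + C1 * \<omega>) * e\<close>
  (\<open>afem_step_contraction\<close>). The Lipschitz property of the error functional transfers
  the error bound and the near-optimality of the returned partition from \<open>v\<close> to \<open>u\<close> at the price \<open>C2 * e\<close>, which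
  enlarges \<open>\<omega>\<close> to \<open>\<omega> + C2\<close> and diminishes \<open>b * \<omega>\<close> to \<open>b * \<omega> - C2\<close>.

  What remains is to see that each reduction step may be called at all: the approximate data,
  a sum of local projections, must be piecewise in the local spaces of the conforming refinement
  (\<open>sum_in_hp_space\<close>, \<open>hp_space_mono\<close>), and the parametric problem must be
  solvable for them (\<open>approximate_data_solvable\<close>). This rests on the geometry of the master tree: two nodes
  are either essentially disjoint or one is an ancestor of the other (\<open>tree_dichotomy\<close>), so
  that the leaves of every subtree tile the same set, the closure of the domain.
\<close>

section \<open>Norms of inner products on a carrier\<close>

lemma hilbert_space_onD:
  assumes "hilbert_space_on H ip"
  shows "subspace H"
    and "\<And>x y. x \<in> H \<Longrightarrow> y \<in> H \<Longrightarrow> ip x y = ip y x"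
    and "\<And>x y z. x \<in> H \<Longrightarrow> y \<in> H \<Longrightarrow> z \<in> H \<Longrightarrow> ip (x + y) z = ip x z + ip y z"
    and "\<And>c x y. x \<in> H \<Longrightarrow> y \<in> H \<Longrightarrow> ip (c *\<^sub>R x) y = c * ip x y"
    and "\<And>x. x \<in> H \<Longrightarrow> ip x x \<ge> 0"
    and "\<And>x. x \<in> H \<Longrightarrow> ip x x = 0 \<Longrightarrow> x = 0"
  using assms by (simp_all add: hilbert_space_on_def)

lemma ip_quadratic:
  assumes H: "hilbert_space_on H ip" and x: "x \<in> H" and y: "y \<in> H"
  shows "ip (a *\<^sub>R x + c *\<^sub>R y) (a *\<^sub>R x + c *\<^sub>R y) = a\<^sup>2 * ip x x + 2 * a * c * ip x y + c\<^sup>2 * ip y y"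
proof -
  note D = hilbert_space_onD[OF H]
  let ?z = "a *\<^sub>R x + c *\<^sub>R y"
  have ax: "a *\<^sub>R x \<in> H" and cy: "c *\<^sub>R y \<in> H" and z: "?z \<in> H"
    using D(1) x y by (auto intro: subspace_add subspace_scale)
  have 1: "ip ?z w = a * ip x w + c * ip y w" if "w \<in> H" for w
    using D(3)[OF ax cy that] D(4) x y that by simp
  have "ip ?z ?z = a * ip ?z x + c * ip ?z y"
    using 1[OF z] D(2)[OF z x] D(2)[OF z y] by simp
  then show ?thesis
    using 1[OF x] 1[OF y] D(2)[OF x y] by (simp add: power2_eq_square algebra_simps)
qed

lemma ip_Cauchy_Schwarz:
  assumes H: "hilbert_space_on H ip" and x: "x \<in> H" and y: "y \<in> H"
  shows "(ip x y)\<^sup>2 \<le> ip x x * ip y y"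
proof (cases "ip y y = 0")
  case True
  then have "y = 0" using hilbert_space_onD(6)[OF H y] by simp
  then have "ip y x = 0"
    using hilbert_space_onD(4)[OF H y x, of 0] by simp
  then have "ip x y = 0"
    unfolding hilbert_space_onD(2)[OF H x y] .
  then show ?thesis by (simp add: True)
next
  case False
  then have pos: "ip y y > 0" using hilbert_space_onD(5)[OF H y] by simp
  \<comment> \<open>A positive multiple of the component of \<open>x\<close> that is orthogonal to \<open>y\<close>.\<close>
  let ?z = "ip y y *\<^sub>R x + (- ip x y) *\<^sub>R y"
  have "?z \<in> H"
    by (intro subspace_add subspace_scale hilbert_space_onD(1)[OF H] x y)
  then have "0 \<le> ip ?z ?z" by (rule hilbert_space_onD(5)[OF H])
  also have "\<dots> = ip y y * (ip x x * ip y y - (ip x y)\<^sup>2)"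
    unfolding ip_quadratic[OF H x y] by (simp add: power2_eq_square algebra_simps)
  finally show ?thesis using pos by (simp add: zero_le_mult_iff)
qed

lemma ip_norm_nonneg: "hilbert_space_on H ip \<Longrightarrow> x \<in> H \<Longrightarrow> 0 \<le> ip_norm ip x"
  unfolding ip_norm_def using hilbert_space_onD(5) by (metis real_sqrt_ge_zero)

lemma ip_norm_triangle:
  assumes H: "hilbert_space_on H ip" and x: "x \<in> H" and y: "y \<in> H"
  shows "ip_norm ip (x + y) \<le> ip_norm ip x + ip_norm ip y"
proof -
  have xx: "0 \<le> ip x x" and yy: "0 \<le> ip y y" using hilbert_space_onD(5)[OF H] x y by auto
  have "ip x y \<le> sqrt (ip x x * ip y y)"
    by (rule real_le_rsqrt) (rule ip_Cauchy_Schwarz[OF H x y])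
  then have "ip x x + 2 * ip x y + ip y y \<le> (sqrt (ip x x) + sqrt (ip y y))\<^sup>2"
    using xx yy by (simp add: power2_sum real_sqrt_mult)
  moreover have "ip (x + y) (x + y) = ip x x + 2 * ip x y + ip y y"
    using ip_quadratic[OF H x y, of 1 1] by simp
  ultimately show ?thesis
    unfolding ip_norm_def using xx yy by (intro real_le_lsqrt) auto
qed

lemma ip_norm_diff_triangle:
  assumes H: "hilbert_space_on H ip" and x: "x \<in> H" and y: "y \<in> H" and z: "z \<in> H"
  shows "ip_norm ip (x - z) \<le> ip_norm ip (x - y) + ip_norm ip (y - z)"
  using ip_norm_triangle[OF H, of "x - y" "y - z"] hilbert_space_onD(1)[OF H] x y z
  by (simp add: subspace_diff)

lemma ip_norm_minus_commute:
  assumes H: "hilbert_space_on H ip" and x: "x \<in> H" and y: "y \<in> H"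
  shows "ip_norm ip (x - y) = ip_norm ip (y - x)"
proof -
  have "ip (x - y) (x - y) = ip (y - x) (y - x)"
    using ip_quadratic[OF H x y, of 1 "-1"] ip_quadratic[OF H x y, of "-1" 1]
    by (simp add: add.commute[of "- x" y])
  then show ?thesis by (simp add: ip_norm_def)
qed

text \<open>The distance to a set is 1-Lipschitz. For the empty set both infima are the same default value.\<close>

lemma ip_distance_to_set_triangle:
  assumes H: "hilbert_space_on H ip" and x: "x \<in> H" and y: "y \<in> H"
    and W: "W \<subseteq> H"
  shows "(INF w\<in>W. ip_norm ip (x - w)) \<le> ip_norm ip (x - y) + (INF w\<in>W. ip_norm ip (y - w))"
proof (cases "W = {}")
  case True
  then show ?thesis
    using ip_norm_nonneg[OF H subspace_diff[OF hilbert_space_onD(1)[OF H] x y]] by simp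
next
  case False
  have bdd: "bdd_below ((\<lambda>w. ip_norm ip (x - w)) ` W)"
    using W x hilbert_space_onD(1)[OF H]
    by (intro bdd_belowI2[where m = 0] ip_norm_nonneg[OF H]) (auto intro: subspace_diff)
  have "(INF w\<in>W. ip_norm ip (x - w)) - ip_norm ip (x - y) \<le> (INF w\<in>W. ip_norm ip (y - w))"
  proof (rule cINF_greatest[OF False])
    fix w assume w: "w \<in> W"
    have "(INF w\<in>W. ip_norm ip (x - w)) \<le> ip_norm ip (x - w)"
      by (rule cINF_lower[OF bdd w])
    also have "\<dots> \<le> ip_norm ip (x - y) + ip_norm ip (y - w)"
      using ip_norm_diff_triangle[OF H x y] w W by blast
    finally show "(INF w\<in>W. ip_norm ip (x - w)) - ip_norm ip (x - y) \<le> ip_norm ip (y - w)"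
      by simp
  qed
  then show ?thesis by simp
qed

section \<open>Restriction of functions modulo null sets\<close>

lemma restr_restr: "restr A (restr B z) = restr (A \<inter> B) z"
  by transfer (simp add: ae_eq_def)

lemma restr_add: "restr A (y + z) = restr A y + restr A z"
  by transfer (simp add: ae_eq_def)

lemma restr_zero [simp]: "restr A 0 = 0"
  by transfer (simp add: ae_eq_def)

lemma restr_sum: "restr A (\<Sum>i\<in>I. g i) = (\<Sum>i\<in>I. restr A (g i))"
  by (induction I rule: infinite_finite_induct) (simp_all add: restr_add)

lemma restr_null:
  assumes "A \<in> null_sets lebesgue"
  shows "restr A z = 0"
  using assms
proof (transfer, unfold ae_eq_def)
  fix A :: "'a set" and z :: "'a \<Rightarrow> 'b"
  assume "A \<in> null_sets lebesgue"
  then have "AE x in lebesgue. x \<notin> A" by (rule AE_not_in)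
  then show "AE x in lebesgue. (if x \<in> A then z x else 0) = 0"
    by (rule eventually_mono) simp
qed

lemma functions_on_mono: "A \<subseteq> B \<Longrightarrow> z \<in> functions_on A \<Longrightarrow> z \<in> functions_on B"
  unfolding functions_on_def mem_Collect_eq by (metis Int_absorb1 restr_restr)

lemma restr_in_functions_on [simp]: "restr A z \<in> functions_on A"
  by (simp add: functions_on_def restr_restr)

lemma sum_in_functions_on: "(\<And>i. i \<in> I \<Longrightarrow> g i \<in> functions_on A) \<Longrightarrow> sum g I \<in> functions_on A"
  by (simp add: functions_on_def restr_sum)

text \<open>On the union of essentially disjoint sets, the function with prescribed restrictions is the sum
  of these restrictions.\<close>

lemma sum_in_piecewise:
  assumes fin: "finite I"
    and disj: "\<And>i j. i \<in> I \<Longrightarrow> j \<in> I \<Longrightarrow> i \<noteq> j \<Longrightarrow> S i \<inter> S j \<in> null_sets lebesgue"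
    and Z: "\<And>i. i \<in> I \<Longrightarrow> Z i \<subseteq> functions_on (S i)"
    and g: "\<And>i. i \<in> I \<Longrightarrow> g i \<in> Z i"
  shows "(\<Sum>i\<in>I. g i) \<in> piecewise I S Z"
  unfolding piecewise_def
proof (intro CollectI conjI ballI)
  have on: "restr (S i) (g i) = g i" if "i \<in> I" for i
    using Z g that unfolding functions_on_def by blast
  show "(\<Sum>i\<in>I. g i) \<in> functions_on (\<Union>i\<in>I. S i)"
  proof (rule sum_in_functions_on)
    fix i assume i: "i \<in> I"
    then have "S i \<subseteq> (\<Union>i\<in>I. S i)" by blast
    then show "g i \<in> functions_on (\<Union>i\<in>I. S i)"
      using subsetD[OF Z[OF i] g[OF i]] by (rule functions_on_mono)
  qed
  fix i assume i: "i \<in> I"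
  have "restr (S i) (g j) = (if j = i then g i else 0)" if j: "j \<in> I" for j
    using on[OF i] on[OF j] restr_restr[of "S i" "S j" "g j"] restr_null[OF disj[OF i j]] by auto
  then have "restr (S i) (\<Sum>j\<in>I. g j) = (\<Sum>j\<in>I. if j = i then g i else 0)"
    unfolding restr_sum by (intro sum.cong) auto
  also have "\<dots> = g i" using fin i by simp
  finally show "restr (S i) (\<Sum>j\<in>I. g j) \<in> Z i" using g[OF i] by simp
qed

section \<open>The geometry of the master tree\<close>

lemma h_frameworkD:
  assumes "h_framework S"
  shows "\<Union>(roots S) = closure (Omega S)"
    and "\<And>R R'. R \<in> roots S \<Longrightarrow> R' \<in> roots S \<Longrightarrow> R \<noteq> R' \<Longrightarrow> R \<inter> R' \<in> null_sets lebesgue"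
    and "\<And>K. K \<in> master_tree S \<Longrightarrow> element_domain K"
    and "\<And>K. K \<in> master_tree S \<Longrightarrow> K = childL S K \<union> childR S K"
    and "\<And>K. K \<in> master_tree S \<Longrightarrow> childL S K \<inter> childR S K \<in> null_sets lebesgue"
proof -
  note A = assms[unfolded h_framework_def]
  show "\<Union>(roots S) = closure (Omega S)" by (rule A[THEN conjunct2, THEN conjunct1])
  show "R \<inter> R' \<in> null_sets lebesgue" if "R \<in> roots S" "R' \<in> roots S" "R \<noteq> R'" for R R'
    using A[THEN conjunct2, THEN conjunct2, THEN conjunct1] that by simp
  note B = A[THEN conjunct2, THEN conjunct2, THEN conjunct2, THEN bspec]
  show "element_domain K" if "K \<in> master_tree S" for K
    by (rule B[OF that, THEN conjunct1])
  show "K = childL S K \<union> childR S K" if "K \<in> master_tree S" for K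
    by (rule B[OF that, THEN conjunct2, THEN conjunct1])
  show "childL S K \<inter> childR S K \<in> null_sets lebesgue" if "K \<in> master_tree S" for K
    by (rule B[OF that, THEN conjunct2, THEN conjunct2])
qed

lemma element_domain_not_null:
  assumes "element_domain K"
  shows "K \<notin> null_sets lebesgue"
proof
  assume null: "K \<in> null_sets lebesgue"
  obtain U where U: "is_domain U" "K = closure U"
    using assms unfolding element_domain_def by blast
  have "negligible U"
    using null U(2) closure_subset by (metis negligible_iff_null_sets negligible_subset)
  then show False
    using U(1) open_not_negligible unfolding is_domain_def by blast
qed

lemma node_not_null: "h_framework S \<Longrightarrow> K \<in> master_tree S \<Longrightarrow> K \<notin> null_sets lebesgue"
  by (rule element_domain_not_null) (rule h_frameworkD(3))

lemma null_Int_mono: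
  fixes A :: "'a::euclidean_space set"
  assumes "A \<inter> B \<in> null_sets lebesgue" "A' \<subseteq> A" "B' \<subseteq> B"
  shows "A' \<inter> B' \<in> null_sets lebesgue"
  using assms by (metis Int_mono negligible_iff_null_sets negligible_subset)

lemma parent_in_tree: "(P, K) \<in> parent_rel S \<Longrightarrow> P \<in> master_tree S"
  by (simp add: parent_rel_def)

lemma child_in_tree: "(P, K) \<in> parent_rel S \<Longrightarrow> K \<in> master_tree S"
  by (auto simp: parent_rel_def intro: master_tree.intros)

lemma parent_superset: "h_framework S \<Longrightarrow> (P, K) \<in> parent_rel S \<Longrightarrow> K \<subseteq> P"
  using h_frameworkD(4)[of S P] by (auto simp: parent_rel_def)

lemma ancestor_superset:
  assumes "h_framework S" "(P, K) \<in> (parent_rel S)\<^sup>*"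
  shows "K \<subseteq> P"
  using assms(2) by induction (use parent_superset[OF assms(1)] in blast)+

lemma children_ess_disjoint:
  assumes "h_framework S" "(P, K) \<in> parent_rel S" "(P, K') \<in> parent_rel S" "K \<noteq> K'"
  shows "K \<inter> K' \<in> null_sets lebesgue"
  using assms h_frameworkD(5)[of S P] by (auto simp: parent_rel_def Int_commute)

text \<open>A child equal to its parent would contain its sibling, which would then be a null set; but an
  element domain, the closure of a nonempty open set, is not.\<close>

lemma child_psubset:
  assumes h: "h_framework S" and r: "(P, K) \<in> parent_rel S"
  shows "K \<subset> P"
proof -
  have P: "P \<in> master_tree S" using r by (rule parent_in_tree)
  have "\<not> P \<subseteq> K"
  proof
    assume sub: "P \<subseteq> K"
    let ?L = "childL S P" and ?R = "childR S P"
    have "?L \<union> ?R \<subseteq> K" using sub h_frameworkD(4)[OF h P] by simp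
    moreover have "K = ?L \<or> K = ?R" using r by (simp add: parent_rel_def)
    ultimately have "?L \<inter> ?R = ?R \<or> ?L \<inter> ?R = ?L" by blast
    then show False
      using h_frameworkD(5)[OF h P] node_not_null[OF h] P master_tree.left master_tree.right
      by metis
  qed
  then show ?thesis using parent_superset[OF h r] by blast
qed

lemma node_has_root:
  assumes "K \<in> master_tree S"
  shows "\<exists>R\<in>roots S. (R, K) \<in> (parent_rel S)\<^sup>*"
  using assms
proof induction
  case (root K) then show ?case by blast
next
  case (left K)
  then have "(K, childL S K) \<in> parent_rel S" by (simp add: parent_rel_def)
  with left show ?case by (meson rtrancl.rtrancl_into_rtrancl)
next
  case (right K)
  then have "(K, childR S K) \<in> parent_rel S" by (simp add: parent_rel_def)
  with right show ?case by (meson rtrancl.rtrancl_into_rtrancl)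
qed

text \<open>The closure conditions on a subtree are imposed on its elements that are not roots; they reach
  every child because no child is a root: it would be strictly smaller than the root above it, but
  not essentially disjoint from it.\<close>

lemma child_not_root:
  assumes h: "h_framework S" and r: "(P, K) \<in> parent_rel S"
  shows "K \<notin> roots S"
proof
  assume K: "K \<in> roots S"
  obtain R where R: "R \<in> roots S" "(R, P) \<in> (parent_rel S)\<^sup>*"
    using node_has_root[OF parent_in_tree[OF r]] by blast
  have PR: "P \<subseteq> R" by (rule ancestor_superset[OF h R(2)])
  have KP: "K \<subset> P" by (rule child_psubset[OF h r])
  then have "K \<noteq> R" using PR by blast
  then have "K \<inter> R \<in> null_sets lebesgue" by (rule h_frameworkD(2)[OF h K R(1)])
  moreover have "K \<inter> R = K" using PR KP by blast
  ultimately show False using node_not_null[OF h child_in_tree[OF r]] by simp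
qed

text \<open>Two nodes that are not related by ancestry lie in different branches below the last common
  ancestor, or below different roots. The proof descends along the first node only; the alternative
  passes from a node to its child.\<close>

lemma tree_dichotomy:
  assumes h: "h_framework S" and K: "K \<in> master_tree S" and K': "K' \<in> master_tree S"
  shows "(K, K') \<in> (parent_rel S)\<^sup>* \<or> (K', K) \<in> (parent_rel S)\<^sup>* \<or> K \<inter> K' \<in> null_sets lebesgue"
proof -
  have step: "(C, K') \<in> (parent_rel S)\<^sup>* \<or> (K', C) \<in> (parent_rel S)\<^sup>* \<or> C \<inter> K' \<in> null_sets lebesgue"
    if r: "(K, C) \<in> parent_rel S"
      and IH: "(K, K') \<in> (parent_rel S)\<^sup>* \<or> (K', K) \<in> (parent_rel S)\<^sup>* \<or> K \<inter> K' \<in> null_sets lebesgue"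
    for K C
  proof -
    consider "K = K'" | "(K, K') \<in> (parent_rel S)\<^sup>*" "K \<noteq> K'" | "(K', K) \<in> (parent_rel S)\<^sup>*"
      | "K \<inter> K' \<in> null_sets lebesgue"
      using IH by blast
    then show ?thesis
    proof cases
      case 1 then show ?thesis using r by blast
    next
      case 2
      then obtain C' where C': "(K, C') \<in> parent_rel S" "(C', K') \<in> (parent_rel S)\<^sup>*"
        by (meson converse_rtranclE)
      show ?thesis
      proof (cases "C = C'")
        case True then show ?thesis using C' by blast
      next
        case False
        show ?thesis
          using null_Int_mono[OF children_ess_disjoint[OF h r C'(1) False]]
            ancestor_superset[OF h C'(2)] by blast
      qed
    next
      case 3 then show ?thesis using r by (meson rtrancl.rtrancl_into_rtrancl)
    next
      case 4 then show ?thesis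
        using null_Int_mono parent_superset[OF h r] by blast
    qed
  qed
  from K show ?thesis
  proof induction
    case (root K)
    obtain R where R: "R \<in> roots S" "(R, K') \<in> (parent_rel S)\<^sup>*"
      using node_has_root[OF K'] by blast
    show ?case
    proof (cases "K = R")
      case True then show ?thesis using R by blast
    next
      case False
      show ?thesis
        using null_Int_mono[OF h_frameworkD(2)[OF h root R(1) False]]
          ancestor_superset[OF h R(2)] by blast
    qed
  next
    case (left K)
    have "(K, childL S K) \<in> parent_rel S" using left.hyps by (simp add: parent_rel_def)
    then show ?case using left.IH by (rule step)
  next
    case (right K)
    have "(K, childR S K) \<in> parent_rel S" using right.hyps by (simp add: parent_rel_def)
    then show ?case using right.IH by (rule step)
  qed
qed

section \<open>Leaves of subtrees tile the domain\<close>

lemma subtree_child_closed: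
  assumes h: "h_framework S" and T: "subtree S T" and r: "(P, C) \<in> parent_rel S" and C: "C \<in> T"
  shows "P \<in> T" "childL S P \<in> T" "childR S P \<in> T"
  using T C r child_not_root[OF h r] unfolding subtree_def by blast+

lemma subtree_ancestor_closed:
  assumes "h_framework S" "subtree S T" "(P, K) \<in> (parent_rel S)\<^sup>*" "K \<in> T"
  shows "P \<in> T"
  using assms(3,4) by (induction rule: converse_rtrancl_induct)
    (auto dest: subtree_child_closed(1)[OF assms(1,2)])

lemma leaf_no_proper_ancestor:
  assumes h: "h_framework S" and T: "subtree S T"
    and K: "K \<in> leaves S T" and K': "K' \<in> T" and r: "(K, K') \<in> (parent_rel S)\<^sup>*"
  shows "K = K'"
proof (rule ccontr)
  assume "K \<noteq> K'"
  with r obtain C where C: "(K, C) \<in> parent_rel S" "(C, K') \<in> (parent_rel S)\<^sup>*"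
    by (meson converse_rtranclE)
  have "C \<in> T" by (rule subtree_ancestor_closed[OF h T C(2) K'])
  then show False using K C(1) by (auto simp: leaves_def parent_rel_def)
qed

lemma leaves_ess_disjoint:
  assumes h: "h_framework S" and T: "subtree S T"
    and K: "K \<in> leaves S T" and K': "K' \<in> leaves S T" and ne: "K \<noteq> K'"
  shows "K \<inter> K' \<in> null_sets lebesgue"
proof -
  have "K \<in> T" "K' \<in> T" "K \<in> master_tree S" "K' \<in> master_tree S"
    using T K K' by (auto simp: subtree_def leaves_def)
  then show ?thesis
    using tree_dichotomy[OF h] leaf_no_proper_ancestor[OF h T] K K' ne by metis
qed

text \<open>Descending from a node to its children ends in leaves, since a subtree is finite and children
  are strictly smaller.\<close>

lemma node_covered_by_leaves:
  assumes h: "h_framework S" and T: "subtree S T" and K: "K \<in> T"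
  shows "K \<subseteq> \<Union>(leaves S T)"
  using K
proof (induction "card {K'\<in>T. K' \<subset> K}" arbitrary: K rule: less_induct)
  case less
  have fin: "finite T" and tree: "K \<in> master_tree S"
    using T less.prems by (auto simp: subtree_def)
  show ?case
  proof (cases "K \<in> leaves S T")
    case True then show ?thesis by blast
  next
    case False
    have L: "(K, childL S K) \<in> parent_rel S" and R: "(K, childR S K) \<in> parent_rel S"
      using tree by (auto simp: parent_rel_def)
    have "childL S K \<in> T \<or> childR S K \<in> T"
      using False less.prems by (auto simp: leaves_def)
    then have T2: "childL S K \<in> T" "childR S K \<in> T"
      using subtree_child_closed(2,3)[OF h T L] subtree_child_closed(2,3)[OF h T R] by blast+
    have "C \<subseteq> \<Union>(leaves S T)" if C: "C \<in> T" "(K, C) \<in> parent_rel S" for C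
    proof (rule less.hyps)
      have "C \<subset> K" by (rule child_psubset[OF h C(2)])
      then have "{K'\<in>T. K' \<subset> C} \<subset> {K'\<in>T. K' \<subset> K}" using C(1) by blast
      then show "card {K'\<in>T. K' \<subset> C} < card {K'\<in>T. K' \<subset> K}"
        using fin by (intro psubset_card_mono) auto
    qed (rule C(1))
    then have "childL S K \<union> childR S K \<subseteq> \<Union>(leaves S T)" using T2 L R by blast
    then show ?thesis unfolding h_frameworkD(4)[OF h tree, symmetric] .
  qed
qed

lemma h_partition_subset_tree: "\<K> \<in> h_partitions S \<Longrightarrow> \<K> \<subseteq> master_tree S"
  by (auto simp: h_partitions_def subtree_def leaves_def)

lemma h_partition_finite: "\<K> \<in> h_partitions S \<Longrightarrow> finite \<K>"
  by (auto simp: h_partitions_def subtree_def leaves_def)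

lemma h_partition_ess_disjoint:
  "h_framework S \<Longrightarrow> \<K> \<in> h_partitions S \<Longrightarrow> K \<in> \<K> \<Longrightarrow> K' \<in> \<K> \<Longrightarrow> K \<noteq> K'
    \<Longrightarrow> K \<inter> K' \<in> null_sets lebesgue"
  using leaves_ess_disjoint by (fastforce simp: h_partitions_def)

lemma h_partition_Union:
  assumes h: "h_framework S" and part: "\<K> \<in> h_partitions S"
  shows "\<Union>\<K> = closure (Omega S)"
proof -
  obtain T where T: "subtree S T" and \<K>: "\<K> = leaves S T"
    using part by (auto simp: h_partitions_def)
  have "\<Union>\<K> \<subseteq> \<Union>(roots S)"
  proof (rule Union_least)
    fix K assume "K \<in> \<K>"
    then obtain R where "R \<in> roots S" "(R, K) \<in> (parent_rel S)\<^sup>*"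
      using h_partition_subset_tree[OF part] node_has_root by blast
    then show "K \<subseteq> \<Union>(roots S)" using ancestor_superset[OF h] by blast
  qed
  moreover have "\<Union>(roots S) \<subseteq> \<Union>\<K>"
    using node_covered_by_leaves[OF h T] T unfolding \<K> subtree_def by blast
  ultimately show ?thesis using h_frameworkD(1)[OF h] by simp
qed

section \<open>Piecewise spaces on hp-partitions\<close>

lemma hp_partitionD:
  assumes "\<D> \<in> hp_partitions S"
  shows "fst ` \<D> \<in> h_partitions S" and "finite \<D>"
    and "\<And>D. D \<in> \<D> \<Longrightarrow> fst D \<in> master_tree S \<and> snd D \<ge> 1"
    and "\<D> \<subseteq> hp_elements S"
  using assms h_partition_finite[of "fst ` \<D>" S] finite_imageD[of fst \<D>]
  by (auto simp: hp_partitions_def hp_elements_def)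

lemma hp_partition_Union:
  "h_framework S \<Longrightarrow> \<D> \<in> hp_partitions S \<Longrightarrow> (\<Union>D\<in>\<D>. fst D) = closure (Omega S)"
  using h_partition_Union hp_partitionD(1) by fastforce

lemma hp_partition_ess_disjoint:
  assumes "h_framework S" "\<D> \<in> hp_partitions S" "D \<in> \<D>" "D' \<in> \<D>" "D \<noteq> D'"
  shows "fst D \<inter> fst D' \<in> null_sets lebesgue"
proof (rule h_partition_ess_disjoint[OF assms(1) hp_partitionD(1)[OF assms(2)]])
  show "fst D \<noteq> fst D'"
    using assms by (auto simp: hp_partitions_def dest: inj_onD)
qed (use assms in auto)

lemma nested_local_spacesD:
  assumes "nested_local_spaces S ZK Zd" "K \<in> master_tree S" "d \<ge> 1"
  shows "ZK K \<subseteq> functions_on K" "Zd (K, d) \<subseteq> ZK K" "Zd (K, d) \<subseteq> Zd (K, d + 1)"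
    "Zd (K, d) \<subseteq> piecewise {childL S K, childR S K} (\<lambda>K'. K') (\<lambda>K'. Zd (K', d))"
  using assms unfolding nested_local_spaces_def by blast+

lemma local_space_degree_mono:
  assumes "nested_local_spaces S ZK Zd" "K \<in> master_tree S" "d \<ge> 1" "d \<le> d'"
  shows "Zd (K, d) \<subseteq> Zd (K, d')"
  using assms(4)
proof (induction d' rule: dec_induct)
  case (step m)
  then show ?case using nested_local_spacesD(3)[OF assms(1,2), of m] assms(3) by auto
qed simp

lemma local_space_restr_descendant:
  assumes h: "h_framework S" and nest: "nested_local_spaces S ZK Zd"
    and P: "P \<in> master_tree S" and d: "d \<ge> 1" and z: "z \<in> functions_on P" "z \<in> Zd (P, d)"
    and r: "(P, K) \<in> (parent_rel S)\<^sup>*"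
  shows "restr K z \<in> Zd (K, d)"
  using r
proof induction
  case base
  then show ?case using z by (simp add: functions_on_def)
next
  case (step C K)
  have C: "C \<in> master_tree S" using step(2) by (rule parent_in_tree)
  have "restr K (restr C z) \<in> Zd (K, d)"
    using step nested_local_spacesD(4)[OF nest C d]
    by (auto simp: parent_rel_def piecewise_def)
  then show ?case
    using parent_superset[OF h step(2)] by (simp add: restr_restr Int_absorb2)
qed

text \<open>Refinement enlarges the piecewise space: a restriction to an element of the finer partition
  factors through its ancestor in the coarser one.\<close>

lemma hp_space_mono:
  assumes h: "h_framework S" and nest: "nested_local_spaces S ZK Zd"
    and \<D>: "\<D> \<in> hp_partitions S" and \<D>': "\<D>' \<in> hp_partitions S" and le: "hp_le S \<D> \<D>'"
  shows "hp_space Zd \<D> \<subseteq> hp_space Zd \<D>'"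
proof
  fix z assume z: "z \<in> hp_space Zd \<D>"
  have "restr (fst D') z \<in> Zd D'" if D': "D' \<in> \<D>'" for D'
  proof -
    obtain D where D: "D \<in> \<D>" and anc: "fst D = fst D' \<or> (fst D, fst D') \<in> (parent_rel S)\<^sup>+"
      using le D' unfolding hp_le_def h_le_def by fastforce
    have deg: "snd D \<le> snd D'" using le D D' anc unfolding hp_le_def by blast
    have r: "(fst D, fst D') \<in> (parent_rel S)\<^sup>*" using anc by (auto intro: trancl_into_rtrancl)
    have "restr (fst D) z \<in> Zd (fst D, snd D)"
      using z D by (simp add: hp_space_def piecewise_def)
    then have "restr (fst D') (restr (fst D) z) \<in> Zd (fst D', snd D)"
      using hp_partitionD(3)[OF \<D> D] by (intro local_space_restr_descendant[OF h nest _ _ _ _ r]) auto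
    then have "restr (fst D') z \<in> Zd (fst D', snd D)"
      using ancestor_superset[OF h r] by (simp add: restr_restr Int_absorb2)
    moreover have "Zd (fst D', snd D) \<subseteq> Zd (fst D', snd D')"
      using local_space_degree_mono[OF nest _ _ deg] hp_partitionD(3)[OF \<D> D]
        hp_partitionD(3)[OF \<D>' D'] by blast
    ultimately show ?thesis by auto
  qed
  then show "z \<in> hp_space Zd \<D>'"
    using z hp_partition_Union[OF h \<D>] hp_partition_Union[OF h \<D>']
    by (simp add: hp_space_def piecewise_def)
qed

lemma sum_in_hp_space:
  assumes h: "h_framework S" and nest: "nested_local_spaces S ZK Zd"
    and \<D>: "\<D> \<in> hp_partitions S" and g: "\<And>D. D \<in> \<D> \<Longrightarrow> g D \<in> Zd D"
  shows "(\<Sum>D\<in>\<D>. g D) \<in> hp_space Zd \<D>"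
  unfolding hp_space_def
proof (rule sum_in_piecewise)
  fix D assume "D \<in> \<D>"
  then have D: "fst D \<in> master_tree S" "snd D \<ge> 1" using hp_partitionD(3)[OF \<D>] by auto
  then show "Zd D \<subseteq> functions_on (fst D)"
    using nested_local_spacesD(1,2)[OF nest D] by simp
qed (use hp_partitionD(2)[OF \<D>] hp_partition_ess_disjoint[OF h \<D>] g in auto)

lemma hp_space_subset_local:
  assumes nest: "nested_local_spaces S ZK Zd" and \<D>: "\<D> \<in> hp_partitions S"
  shows "hp_space Zd \<D> \<subseteq> piecewise (fst ` \<D>) (\<lambda>K. K) ZK"
proof
  fix z assume z: "z \<in> hp_space Zd \<D>"
  have "restr (fst D) z \<in> ZK (fst D)" if "D \<in> \<D>" for D
    using z that hp_partitionD(3)[OF \<D> that] nested_local_spacesD(2)[OF nest, of "fst D" "snd D"]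
    by (auto simp: hp_space_def piecewise_def)
  then show "z \<in> piecewise (fst ` \<D>) (\<lambda>K. K) ZK"
    using z by (auto simp: hp_space_def piecewise_def)
qed

section \<open>Consequences of the framework\<close>

lemma frameworkD:
  assumes "hp_framework S"
  shows "h_framework S"
    and "hilbert_space_on (spV S) (ipV S)"
    and "nested_local_spaces S (locF S) (hpF S)"
    and "nested_local_spaces S (locL S) (hpL S)"
  using assms by (auto simp: hp_framework_def parametric_problem_def local_spaces_def)

lemma sol_in_spV:
  assumes S: "hp_framework S" and f: "f \<in> spF S" and l: "l \<in> LamBar S"
  shows "sol S f l \<in> spV S"
proof -
  have "\<exists>!v. v \<in> spV S \<and> opA S l v = embF S f"
    using S f l by (simp add: hp_framework_def parametric_problem_def)
  from theI'[OF this] show ?thesis by (simp add: sol_def)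
qed

lemma totalE_nonneg:
  assumes S: "hp_framework S" and \<D>: "\<D> \<in> hp_partitions S"
    and v: "v \<in> spV S" "f \<in> spF S" "l \<in> Lam S"
  shows "0 \<le> totalE S \<D> v f l"
  unfolding totalE_def
proof (rule sum_nonneg)
  fix D assume "D \<in> \<D>"
  then have "fst D \<in> master_tree S" "snd D \<ge> 1" using hp_partitionD(3)[OF \<D>] by auto
  then have "0 \<le> err S (fst D, snd D) v f l"
    using S v unfolding hp_framework_def error_functionals_def by blast
  then show "0 \<le> err S D v f l" by simp
qed

lemma approximate_data_in_hp_space:
  assumes S: "hp_framework S" and \<D>: "\<D> \<in> hp_partitions S" and f: "f \<in> spF S" and l: "l \<in> Lam S"
  shows "partF S \<D> f l \<in> hp_space (hpF S) \<D>" and "partL S \<D> f l \<in> hp_space (hpL S) \<D>"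
proof -
  note D = frameworkD[OF S]
  \<comment> \<open>The projected data do not depend on the first argument, so any element of the space serves.\<close>
  have zero: "0 \<in> spV S" using hilbert_space_onD(1)[OF D(2)] by (rule subspace_0)
  have "projF S E f l \<in> hpF S E \<and> projL S E f l \<in> hpL S E" if "E \<in> \<D>" for E
  proof -
    have "E \<in> hp_elements S" using hp_partitionD(4)[OF \<D>] that by blast
    then have "projQ S E (0, f, l) \<in> hpV S E \<times> hpF S E \<times> hpL S E"
      using S zero f l unfolding hp_framework_def projectors_def by blast
    then show ?thesis by (simp add: projQ_def)
  qed
  then show "partF S \<D> f l \<in> hp_space (hpF S) \<D>" "partL S \<D> f l \<in> hp_space (hpL S) \<D>"
    unfolding partF_def partL_def
    by (auto intro!: sum_in_hp_space[OF D(1) D(3) \<D>] sum_in_hp_space[OF D(1) D(4) \<D>])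
qed

text \<open>Approximate parameters need not be admissible, but the problem is uniquely solvable on the
  larger parameter set, which contains all piecewise parameters.\<close>

lemma approximate_data_solvable:
  assumes S: "hp_framework S" and \<D>: "\<D> \<in> hp_partitions S" and f: "f \<in> spF S" and l: "l \<in> Lam S"
  shows "partF S \<D> f l \<in> spF S" and "partL S \<D> f l \<in> LamBar S"
proof -
  note D = frameworkD[OF S] and A = approximate_data_in_hp_space[OF S \<D> f l]
  have "spF S = piecewise (fst ` \<D>) (\<lambda>K. K) (locF S)"
    "piecewise (fst ` \<D>) (\<lambda>K. K) (locL S) \<subseteq> LamBar S"
    using S hp_partitionD(1)[OF \<D>] unfolding hp_framework_def local_spaces_def by blast+
  then show "partF S \<D> f l \<in> spF S" "partL S \<D> f l \<in> LamBar S"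
    using A hp_space_subset_local[OF D(3) \<D>] hp_space_subset_local[OF D(4) \<D>] by blast+
qed

section \<open>One iteration of the adaptive method\<close>

text \<open>The reduction routine may be called with the approximate data on the conforming refinement, and
  its output is measured against the distance of any element of the space to the discrete space.\<close>

lemma reduce_step:
  assumes S: "hp_framework S" and red: "is_reduce S reduce"
    and \<D>: "\<D> \<in> hp_partitions S" and f: "f \<in> spF S" and l: "l \<in> Lam S"
    and \<rho>: "0 < \<rho>" "\<rho> \<le> 1"
    and out: "(\<D>', v') = reduce \<rho> (conf S \<D>) (partF S \<D> f l) (partL S \<D> f l)"
    and v: "v \<in> spV S"
  shows "v' \<in> spV S"
    and "normV S (sol S (partF S \<D> f l) (partL S \<D> f l) - v')
      \<le> \<rho> * (normV S (sol S (partF S \<D> f l) (partL S \<D> f l) - v)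
              + (INF w\<in>Vc S (conf S \<D>). normV S (v - w)))"
proof -
  note D = frameworkD[OF S]
  let ?f = "partF S \<D> f l" and ?l = "partL S \<D> f l"
  have conf: "conf S \<D> \<in> confD S" "conf S \<D> \<in> hp_partitions S" "hp_le S \<D> (conf S \<D>)"
    using S \<D> unfolding hp_framework_def conforming_def by blast+
  have "?f \<in> hp_space (hpF S) (conf S \<D>)" "?l \<in> hp_space (hpL S) (conf S \<D>)"
    using approximate_data_in_hp_space[OF S \<D> f l]
      hp_space_mono[OF D(1) D(3) \<D> conf(2,3)] hp_space_mono[OF D(1) D(4) \<D> conf(2,3)] by blast+
  moreover have "\<rho> \<in> {0<..1}" using \<rho> by simp
  ultimately obtain \<D>'' u' where "u' \<in> Vc S \<D>''" "reduce \<rho> (conf S \<D>) ?f ?l = (\<D>'', u')"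
    and bound: "normV S (sol S ?f ?l - u') \<le> \<rho> * (INF w\<in>Vc S (conf S \<D>). normV S (sol S ?f ?l - w))"
    using red conf(1) unfolding is_reduce_def by blast
  then have v': "v' = u'" "v' \<in> Vc S \<D>''" using out by auto
  then show "v' \<in> spV S" by (simp add: Vc_def)
  have "sol S ?f ?l \<in> spV S"
    using approximate_data_solvable[OF S \<D> f l] by (rule sol_in_spV[OF S])
  then have "(INF w\<in>Vc S (conf S \<D>). normV S (sol S ?f ?l - w))
      \<le> normV S (sol S ?f ?l - v) + (INF w\<in>Vc S (conf S \<D>). normV S (v - w))"
    unfolding normV_def using v
    by (intro ip_distance_to_set_triangle[OF D(2)]) (auto simp: Vc_def)
  from mult_left_mono[OF this] \<rho>(1) bound v'(1)
  show "normV S (sol S ?f ?l - v')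
      \<le> \<rho> * (normV S (sol S ?f ?l - v) + (INF w\<in>Vc S (conf S \<D>). normV S (v - w)))"
    by (meson less_imp_le order_trans)
qed

text \<open>The factor in the reduction step is the reciprocal of the constant in the bound for the
  distance of the perturbed solution to the discrete space, so that this distance becomes
  \<open>\<mu> * e\<close>; the perturbation of the data contributes the remaining \<open>C1 * \<omega> * e\<close>.\<close>

lemma afem_step_contraction:
  assumes S: "hp_framework S" and red: "is_reduce S reduce"
    and \<D>: "\<D> \<in> hp_partitions S" and f: "f \<in> spF S" and l: "l \<in> Lam S"
    and C1: "0 \<le> C1" and C3: "0 \<le> C3" and \<mu>: "0 < \<mu>" "\<mu> \<le> 1" and \<omega>: "0 \<le> \<omega>"
    and data_error: "normV S (sol S f l - sol S (partF S \<D> f l) (partL S \<D> f l))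
        \<le> C1 * (INF w\<in>spV S. sqrt (totalE S \<D> w f l))"
    and conforming_error: "(INF w\<in>Vc S (conf S \<D>). normV S (v - w))
        \<le> C3 * (INF (f, l)\<in>spF S \<times> Lam S. sqrt (totalE S \<D> v f l))"
    and v: "v \<in> spV S" and dist: "normV S (sol S f l - v) \<le> e"
    and E: "sqrt (totalE S \<D> v f l) \<le> \<omega> * e"
    and out: "(\<D>', v') = reduce (\<mu> / (1 + (C1 + C3) * \<omega>)) (conf S \<D>) (partF S \<D> f l) (partL S \<D> f l)"
  shows "v' \<in> spV S" and "normV S (sol S f l - v') \<le> (\<mu> + C1 * \<omega>) * e"
proof -
  note H = frameworkD(2)[OF S]
  let ?u = "sol S f l" and ?u' = "sol S (partF S \<D> f l) (partL S \<D> f l)"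
  define c where "c = 1 + (C1 + C3) * \<omega>"
  have c: "c \<ge> 1" using C1 C3 \<omega> by (simp add: c_def)
  have u: "?u \<in> spV S"
    using sol_in_spV[OF S f] S l by (auto simp: hp_framework_def parametric_problem_def)
  have u': "?u' \<in> spV S"
    using approximate_data_solvable[OF S \<D> f l] by (rule sol_in_spV[OF S])
  have nonneg: "0 \<le> sqrt (totalE S \<D> w g k)" if "w \<in> spV S" "g \<in> spF S" "k \<in> Lam S" for w g k
    using totalE_nonneg[OF S \<D> that] by simp
  have "(INF w\<in>spV S. sqrt (totalE S \<D> w f l)) \<le> sqrt (totalE S \<D> v f l)"
    using nonneg f l v by (intro cINF_lower bdd_belowI2[where m = 0]) auto
  then have "(INF w\<in>spV S. sqrt (totalE S \<D> w f l)) \<le> \<omega> * e" using E by simp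
  from mult_left_mono[OF this C1] data_error have pert: "normV S (?u - ?u') \<le> C1 * (\<omega> * e)"
    by simp
  have "(INF (f, l)\<in>spF S \<times> Lam S. sqrt (totalE S \<D> v f l)) \<le> sqrt (totalE S \<D> v f l)"
    using nonneg f l v
      cINF_lower[of "\<lambda>(f, l). sqrt (totalE S \<D> v f l)" "spF S \<times> Lam S" "(f, l)"]
    by (force intro: bdd_belowI2[where m = 0])
  then have "(INF (f, l)\<in>spF S \<times> Lam S. sqrt (totalE S \<D> v f l)) \<le> \<omega> * e" using E by simp
  from mult_left_mono[OF this C3] conforming_error
  have best: "(INF w\<in>Vc S (conf S \<D>). normV S (v - w)) \<le> C3 * (\<omega> * e)" by simp
  have \<rho>: "0 < \<mu> / c" "\<mu> / c \<le> 1" using \<mu> c by (simp_all add: divide_le_eq)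
  note red_step = reduce_step[OF S red \<D> f l \<rho> out[folded c_def] v]
  show v': "v' \<in> spV S" by (rule red_step(1))
  have "normV S (?u' - v) \<le> normV S (?u' - ?u) + normV S (?u - v)"
    unfolding normV_def by (rule ip_norm_diff_triangle[OF H u' u v])
  also have "\<dots> \<le> C1 * (\<omega> * e) + e"
    using pert dist ip_norm_minus_commute[OF H u' u] by (simp add: normV_def)
  finally have "normV S (?u' - v) + (INF w\<in>Vc S (conf S \<D>). normV S (v - w)) \<le> c * e"
    using best by (simp add: c_def algebra_simps)
  from mult_left_mono[OF this, of "\<mu> / c"] red_step(2) \<rho>(1)
  have "normV S (?u' - v') \<le> \<mu> / c * (c * e)" by simp
  also have "\<dots> = \<mu> * e" using c by simp
  finally have "normV S (?u' - v') \<le> \<mu> * e" .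
  moreover have "normV S (?u - v') \<le> normV S (?u - ?u') + normV S (?u' - v')"
    unfolding normV_def by (rule ip_norm_diff_triangle[OF H u u' v'])
  ultimately show "normV S (?u - v') \<le> (\<mu> + C1 * \<omega>) * e"
    using pert by (simp add: algebra_simps)
qed

section \<open>Convergence and near-optimality\<close>

theorem corollary2p1:
  fixes S :: "('n::finite, 'p::real_vector, 'q::real_vector, 'r::real_vector, 'w) hp_data"
    and nearbest :: "('n, 'p, 'q, 'r) nearbest_routine"
    and reduce :: "('n, 'p, 'q, 'r) reduce_routine"
    and b B C1 C2 \<mu> \<omega> \<epsilon>0 :: real
    and C3 :: "'n hppart \<Rightarrow> real"
    and f :: "('n, 'q) fn" and l :: "('n, 'r) fn" and u u0 :: "('n, 'p) fn"
    and \<D> \<D>bar :: "nat \<Rightarrow> 'n hppart"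
    and fD :: "nat \<Rightarrow> ('n, 'q) fn" and lD :: "nat \<Rightarrow> ('n, 'r) fn"
    and ubar :: "nat \<Rightarrow> ('n, 'p) fn" and \<epsilon> :: "nat \<Rightarrow> real"
  assumes framework: "hp_framework S"
    and b: "0 < b" "b \<le> 1" and B: "1 \<le> B"
    and nearbest: "is_hp_nearbest S b B nearbest"
    and reduce: "is_reduce S reduce"
    and C1: "C1 > 0" and C2: "C2 > 0" and C12: "C1 * C2 < b"
    and C3: "\<And>\<D>. \<D> \<in> hp_partitions S \<Longrightarrow> C3 \<D> \<ge> 0"
    and data_error: "\<And>\<D> f l. \<D> \<in> hp_partitions S \<Longrightarrow> f \<in> spF S \<Longrightarrow> l \<in> Lam S \<Longrightarrow>
      normV S (sol S f l - sol S (partF S \<D> f l) (partL S \<D> f l))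
        \<le> C1 * (INF w\<in>spV S. sqrt (totalE S \<D> w f l))"
    and lipschitz: "\<And>\<D> v w. \<D> \<in> hp_partitions S \<Longrightarrow> v \<in> spV S \<Longrightarrow> w \<in> spV S \<Longrightarrow>
      (SUP (f, l)\<in>spF S \<times> Lam S. ereal \<bar>sqrt (totalE S \<D> w f l) - sqrt (totalE S \<D> v f l)\<bar>)
        \<le> ereal (C2 * normV S (w - v))"
    and conforming_error: "\<And>\<D> v. \<D> \<in> hp_partitions S \<Longrightarrow> v \<in> spV S \<Longrightarrow>
      (INF w\<in>Vc S (conf S \<D>). normV S (v - w))
        \<le> C3 \<D> * (INF (f, l)\<in>spF S \<times> Lam S. sqrt (totalE S \<D> v f l))"
    and f: "f \<in> spF S" and l: "l \<in> Lam S" and u: "u = sol S f l"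
    and u0: "u0 \<in> spV S" and \<epsilon>0: "\<epsilon>0 > 0" and init: "normV S (u - u0) \<le> \<epsilon>0"
    and \<mu>: "0 < \<mu>" "\<mu> < 1" and \<mu>_C12: "C1 * C2 < b * (1 - \<mu>)"
    and \<omega>: "\<omega> > 0" "\<omega> \<in> {C2 / b <..< (1 - \<mu>) / C1}"
    and run: "hp_afem_run S nearbest reduce C1 C3 \<mu> \<omega> u0 f l \<epsilon>0 \<D> fD lD \<D>bar ubar \<epsilon>"
  shows "(\<forall>i. \<epsilon> i = (\<mu> + C1 * \<omega>) ^ i * \<epsilon>0) \<and>
    (\<forall>i. normV S (u - ubar i) \<le> \<epsilon> i) \<and>
    (\<forall>i\<ge>1. sqrt (totalE S (\<D> i) u f l) \<le> (\<omega> + C2) * \<epsilon> (i - 1)) \<and>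
    (\<forall>i\<ge>1. \<forall>\<D>'\<in>hp_partitions S.
       sqrt (totalE S \<D>' u f l) \<le> (b * \<omega> - C2) * \<epsilon> (i - 1) \<longrightarrow>
       real (hp_card (\<D> i)) \<le> B * real (hp_card \<D>'))"
proof -
  note H = frameworkD(2)[OF framework]
  have uV: "u \<in> spV S"
    using sol_in_spV[OF framework f] framework l u
    by (auto simp: hp_framework_def parametric_problem_def)
  have q: "\<mu> + C1 * \<omega> > 0" using \<mu> C1 \<omega>(1) by (simp add: add_pos_pos)
  have eps_Suc: "\<epsilon> (Suc i) = (\<mu> + C1 * \<omega>) * \<epsilon> i" for i
    using run by (auto simp: hp_afem_run_def dest: spec[of _ "Suc i"])
  have eps: "\<epsilon> i = (\<mu> + C1 * \<omega>) ^ i * \<epsilon>0" for i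
    using run eps_Suc by (induction i) (simp_all add: hp_afem_run_def)
  have eps_pos: "\<epsilon> i > 0" for i using eps q \<epsilon>0 by simp

  have nb: "\<D> (Suc i) \<in> hp_partitions S \<and> fD (Suc i) = partF S (\<D> (Suc i)) f l
      \<and> lD (Suc i) = partL S (\<D> (Suc i)) f l
      \<and> sqrt (totalE S (\<D> (Suc i)) (ubar i) f l) \<le> \<omega> * \<epsilon> i
      \<and> (\<forall>\<D>'\<in>hp_partitions S. sqrt (totalE S \<D>' (ubar i) f l) \<le> b * (\<omega> * \<epsilon> i) \<longrightarrow>
           real (hp_card (\<D> (Suc i))) \<le> B * real (hp_card \<D>'))"
    if "ubar i \<in> spV S" for i
  proof -
    have eq: "nearbest (\<omega> * \<epsilon> i) (ubar i) f l = (\<D> (Suc i), fD (Suc i), lD (Suc i))"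
      using run by (auto simp: hp_afem_run_def dest: spec[of _ "Suc i"])
    have "\<omega> * \<epsilon> i > 0" using \<omega>(1) eps_pos by simp
    with nearbest that f l obtain \<D>0 where
      "\<D>0 \<in> hp_partitions S"
      "nearbest (\<omega> * \<epsilon> i) (ubar i) f l = (\<D>0, partF S \<D>0 f l, partL S \<D>0 f l)"
      "sqrt (totalE S \<D>0 (ubar i) f l) \<le> \<omega> * \<epsilon> i"
      "\<forall>\<D>'\<in>hp_partitions S. sqrt (totalE S \<D>' (ubar i) f l) \<le> b * (\<omega> * \<epsilon> i) \<longrightarrow>
           real (hp_card \<D>0) \<le> B * real (hp_card \<D>')"
      unfolding is_hp_nearbest_def by meson
    then show ?thesis using eq by auto
  qed

  have iter: "ubar i \<in> spV S \<and> normV S (u - ubar i) \<le> \<epsilon> i" for i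
  proof (induction i)
    case 0
    then show ?case using run u0 init by (simp add: hp_afem_run_def)
  next
    case (Suc i)
    then have v: "ubar i \<in> spV S" and d: "normV S (sol S f l - ubar i) \<le> \<epsilon> i" using u by auto
    let ?D = "\<D> (Suc i)"
    have D: "?D \<in> hp_partitions S" and E: "sqrt (totalE S ?D (ubar i) f l) \<le> \<omega> * \<epsilon> i"
      using nb[OF v] by auto
    have out: "(\<D>bar (Suc i), ubar (Suc i)) =
        reduce (\<mu> / (1 + (C1 + C3 ?D) * \<omega>)) (conf S ?D) (partF S ?D f l) (partL S ?D f l)"
      using run nb[OF v] by (auto simp: hp_afem_run_def dest: spec[of _ "Suc i"])
    show ?case
      using afem_step_contraction[OF framework reduce D f l less_imp_le[OF C1] C3[OF D] \<mu>(1)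
          less_imp_le[OF \<mu>(2)] less_imp_le[OF \<omega>(1)] data_error[OF D f l]
          conforming_error[OF D v] v d E out] u eps_Suc by simp
  qed

  have lip: "\<bar>sqrt (totalE S \<D>' (ubar i) f l) - sqrt (totalE S \<D>' u f l)\<bar> \<le> C2 * \<epsilon> i"
    if D': "\<D>' \<in> hp_partitions S" for \<D>' i
  proof -
    let ?g = "\<lambda>(f, l). ereal \<bar>sqrt (totalE S \<D>' (ubar i) f l) - sqrt (totalE S \<D>' u f l)\<bar>"
    have "?g (f, l) \<le> (SUP p\<in>spF S \<times> Lam S. ?g p)"
      using f l by (intro SUP_upper) simp
    also have "\<dots> \<le> ereal (C2 * normV S (ubar i - u))"
      using iter by (intro lipschitz[OF D' uV]) simp
    finally have "\<bar>sqrt (totalE S \<D>' (ubar i) f l) - sqrt (totalE S \<D>' u f l)\<bar>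
        \<le> C2 * normV S (ubar i - u)" by simp
    also have "\<dots> \<le> C2 * \<epsilon> i"
      using iter[of i] ip_norm_minus_commute[OF H, of "ubar i" u] uV C2 by (simp add: normV_def)
    finally show ?thesis .
  qed

  have bound: "sqrt (totalE S (\<D> (Suc i)) u f l) \<le> (\<omega> + C2) * \<epsilon> i" for i
    using nb[of i] iter[of i] lip[of "\<D> (Suc i)" i] by (auto simp: algebra_simps)
  have opt: "real (hp_card (\<D> (Suc i))) \<le> B * real (hp_card \<D>')"
    if D': "\<D>' \<in> hp_partitions S" and le: "sqrt (totalE S \<D>' u f l) \<le> (b * \<omega> - C2) * \<epsilon> i" for \<D>' i
  proof -
    have "sqrt (totalE S \<D>' (ubar i) f l) \<le> b * (\<omega> * \<epsilon> i)"
      using lip[OF D', of i] le by (simp add: algebra_simps)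
    then show ?thesis using nb[of i] iter[of i] D' by blast
  qed
  show ?thesis
  proof (intro conjI allI impI ballI)
    fix i :: nat assume "1 \<le> i"
    then obtain j where i: "i = Suc j" by (cases i) auto
    show "sqrt (totalE S (\<D> i) u f l) \<le> (\<omega> + C2) * \<epsilon> (i - 1)" using bound i by simp
    fix \<D>' assume "\<D>' \<in> hp_partitions S"
      "sqrt (totalE S \<D>' u f l) \<le> (b * \<omega> - C2) * \<epsilon> (i - 1)"
    then show "real (hp_card (\<D> i)) \<le> B * real (hp_card \<D>')" using opt i by simp
  qed (use eps iter in auto)
qed

end
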